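(* Let $n\ge 1$ and $0<k<1$. Let $a_1,\ldots,a_{n+1}>0$ be fixed, and let $\ell(\boldsymbol{x},z)=\sum_{i=1}^n\frac{x_i^2}{a_i^2}+\frac{z^2}{a_{n+1}^2}$. Put $$L_0(t)=\frac{\pi^{n/2}}{\Gamma(n/2+1)}\int_t^1(1-\zeta^2)^{n/2}\,d\zeta,\qquad L(t)=a_1\cdots a_{n+1}\,L_0(t).$$ The volume of the $(n+1)$-dimensional compact set $\mathcal{S}$ of smaller Euclidean volume cut off from the ellipsoid $\ell(\boldsymbol{x},z)=1$ by any hyperplane tangent to the ellipsoid $\ell(\boldsymbol{x},z)=k^2$ is constant and equal to $L(k)$. Conversely, let $\mathcal{M}=\phi^{-1}(0)$ be a $C^{(2)}$-ovaloid lying inside the ellipsoid $\ell(\boldsymbol{x},z)=1$. If the volume of the $(n+1)$-dimensional compact set $\mathcal{S}$ of smaller Euclidean volume cut off from the ellipsoid $\ell(\boldsymbol{x},z)=1$ by any hyperplane tangent to $\mathcal{M}$ is constant and equal to $V$, then (except for a multiplicative constant) $\phi(\boldsymbol{x},z)=\ell(\boldsymbol{x},z)-k^2$, where $k=L^{-1}(V)$.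
   Context: Points of the Euclidean space $E^{n+1}$ are written $(\boldsymbol{x},z)=(x_1,\ldots,x_n,z)$. A nonempty set $\mathcal{M}\subset E^{n+1}$ is a $C^{(2)}$-surface if there are an open set $A\subset E^{n+1}$ and a real-valued function $g\in C^{(2)}(A)$ such that $\sum_{i=1}^n|g_{x_i}(\boldsymbol{x},z)|+|g_z(\boldsymbol{x},z)|>0$ whenever $g(\boldsymbol{x},z)=0$, and $\mathcal{M}=g^{-1}(0)$; here the function is called $\phi$. A $C^{(2)}$-ovaloid is a $C^{(2)}$-surface $\mathcal{M}$ such that $\mathcal{M}=\partial K$ for some compact convex set $K\subset E^{n+1}$ with nonempty interior. A hyperplane meeting the interior $\{\ell<1\}$ divides the solid $\{\ell\le 1\}$ into two compact sets; the one of smaller volume is considered.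
   Formalization: "Except for a multiplicative constant φ=ℓ−k²" fails, e.g. for φ=e^z(ℓ−k²); what is proved is that M is the ellipsoid ℓ=k² with k=L^{-1}(V) and φ=μ·(ℓ−k²) on its domain with μ continuous and nowhere zero. *)

theory Defs
  imports "HOL-Analysis.Analysis"
begin

text \<open>
  Euclidean space of dimension \<open>n + 1\<close> is \<open>(real ^ 'n) \<times> real\<close> with \<open>n = CARD('n) \<ge> 1\<close>, whose
  product norm and inner product are the Euclidean ones.  A real-valued function with domain \<open>A\<close>
  is a total function of which only the values on the open set \<open>A\<close> matter.
\<close>

definition C2_on :: "'a::real_normed_vector set \<Rightarrow> ('a \<Rightarrow> real) \<Rightarrow> bool" where
  "C2_on A g \<longleftrightarrow>
     (\<exists>(g' :: 'a \<Rightarrow> 'a \<Rightarrow>\<^sub>L real) (g'' :: 'a \<Rightarrow> 'a \<Rightarrow>\<^sub>L ('a \<Rightarrow>\<^sub>L real)).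
        (\<forall>p\<in>A. (g has_derivative blinfun_apply (g' p)) (at p)) \<and>
        (\<forall>p\<in>A. (g' has_derivative blinfun_apply (g'' p)) (at p)) \<and>
        continuous_on A g'')"

definition C2_defining_function ::
    "((real ^ 'n) \<times> real) set \<Rightarrow> ((real ^ 'n) \<times> real \<Rightarrow> real) \<Rightarrow> ((real ^ 'n) \<times> real) set \<Rightarrow> bool" where
  "C2_defining_function A g M \<longleftrightarrow>
     open A \<and> C2_on A g \<and>
     (\<forall>p\<in>A. g p = 0 \<longrightarrow>
        (\<Sum>i\<in>UNIV. \<bar>frechet_derivative g (at p) (axis i 1, 0)\<bar>)
          + \<bar>frechet_derivative g (at p) (0, 1)\<bar> > 0) \<and>
     M = {p \<in> A. g p = 0}"

definition C2_surface :: "((real ^ 'n) \<times> real) set \<Rightarrow> bool" where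
  "C2_surface M \<longleftrightarrow> M \<noteq> {} \<and> (\<exists>A g. C2_defining_function A g M)"

definition C2_ovaloid :: "((real ^ 'n) \<times> real) set \<Rightarrow> bool" where
  "C2_ovaloid M \<longleftrightarrow>
     C2_surface M \<and> (\<exists>K. compact K \<and> convex K \<and> interior K \<noteq> {} \<and> M = frontier K)"

definition tangent_hyperplanes ::
    "'a::real_normed_vector set \<Rightarrow> ('a \<Rightarrow> real) \<Rightarrow> 'a set set" where
  "tangent_hyperplanes A g =
     {{q. frechet_derivative g (at p) (q - p) = 0} | p. p \<in> A \<and> g p = 0}"

text \<open>
  The equation of a hyperplane \<open>H\<close> is determined up to a nonzero factor; changing the sign of
  \<open>(u, b)\<close> exchanges the two closed half-spaces bounded by \<open>H\<close>, so either part of \<open>K\<close> is a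
  candidate for \<open>S\<close>.  If both have the same volume, both qualify.
\<close>

definition smaller_part_cut_off :: "'a::euclidean_space set \<Rightarrow> 'a set \<Rightarrow> 'a set \<Rightarrow> bool" where
  "smaller_part_cut_off K H S \<longleftrightarrow>
     (\<exists>u b. u \<noteq> 0 \<and> H = {q. u \<bullet> q = b} \<and>
        S = K \<inter> {q. u \<bullet> q \<le> b} \<and>
        measure lebesgue S \<le> measure lebesgue (K \<inter> {q. u \<bullet> q \<ge> b}))"

text \<open>The semi-axis \<open>a\<^sub>n\<^sub>+\<^sub>1\<close> is passed separately, as \<open>c\<close>.\<close>

definition ell :: "real ^ 'n \<Rightarrow> real \<Rightarrow> (real ^ 'n) \<times> real \<Rightarrow> real" where
  "ell a c p = (\<Sum>i\<in>UNIV. (fst p $ i)\<^sup>2 / (a $ i)\<^sup>2) + (snd p)\<^sup>2 / c\<^sup>2"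

definition L0 :: "nat \<Rightarrow> real \<Rightarrow> real" where
  "L0 n t = pi powr (real n / 2) / Gamma (real n / 2 + 1)
     * integral {t..1} (\<lambda>\<zeta>. (1 - \<zeta>\<^sup>2) powr (real n / 2))"

definition L :: "real ^ 'n \<Rightarrow> real \<Rightarrow> real \<Rightarrow> real" where
  "L a c t = (\<Prod>i\<in>UNIV. a $ i) * c * L0 CARD('n) t"

end

theory Submission
  imports Defs
begin

text \<open>
  The linear map \<open>T\<close> with diagonal \<open>(a, c)\<close> carries the unit ball to the solid ellipsoid and a
  half-space \<open>b \<le> u \<bullet> q\<close> pulls back to one at signed distance \<open>b / |T u|\<close> from the origin.  By
  rotation invariance and Fubini the part cut off has volume \<open>L (b / |T u|)\<close>, which is strictly
  decreasing in that distance; so the smaller part has volume \<open>L (|b| / |T u|)\<close>.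

  For the converse, every direction \<open>u\<close> attains its maximum \<open>h u\<close> over the convex body \<open>K\<close> at a point
  of \<open>M\<close>, and the tangent hyperplane there is \<open>u \<bullet> q = h u\<close>.  Constancy of the volume and
  injectivity of \<open>L\<close> give \<open>|h u| = k |T u|\<close>; since \<open>h u + h (- u) > 0\<close>, the sign is always positive and
  \<open>k > 0\<close>.  Hence \<open>K\<close> has the support function of \<open>\<ell> \<le> k\<^sup>2\<close>, and so \<open>K\<close> is that ellipsoid.
  Finally \<open>\<phi> / (\<ell> - k\<^sup>2)\<close> extends continuously and without zeros across \<open>M\<close>, by the mean value
  theorem along rays.
\<close>

section \<open>Shears and rotations of the unit ball\<close>

lemma emeasure_lborel_Pair:
  fixes X :: "('a::euclidean_space \<times> 'b::euclidean_space) set"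
  assumes "X \<in> sets borel"
  shows "emeasure lborel X = (\<integral>\<^sup>+x. emeasure lborel (Pair x -` X) \<partial>lborel)"
    and "emeasure lborel X = (\<integral>\<^sup>+y. emeasure lborel ((\<lambda>x. (x, y)) -` X) \<partial>lborel)"
proof -
  have "X \<in> sets (lborel \<Otimes>\<^sub>M lborel)"
    unfolding lborel_prod using assms by simp
  from lborel.emeasure_pair_measure_alt[OF this] lborel_pair.emeasure_pair_measure_alt2[OF this]
  show "emeasure lborel X = (\<integral>\<^sup>+x. emeasure lborel (Pair x -` X) \<partial>lborel)"
    and "emeasure lborel X = (\<integral>\<^sup>+y. emeasure lborel ((\<lambda>x. (x, y)) -` X) \<partial>lborel)"
    by (simp_all add: lborel_prod)
qed

text \<open>On each slice with fixed first coordinate the shear is a translation, so Tonelli's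
  theorem and translation invariance suffice.\<close>

lemma shear_snd_measure_preserving:
  fixes f :: "'a::euclidean_space \<Rightarrow> 'b::euclidean_space"
  assumes [measurable]: "f \<in> borel_measurable borel"
  shows "distr lborel borel (\<lambda>q. (fst q, snd q + f (fst q))) = (lborel :: ('a \<times> 'b) measure)"
proof (rule measure_eqI)
  let ?S = "\<lambda>q. (fst q, snd q + f (fst q))"
  fix X :: "('a \<times> 'b) set" assume "X \<in> sets (distr lborel borel ?S)"
  hence X: "X \<in> sets borel" by simp
  have S: "?S \<in> borel \<rightarrow>\<^sub>M borel"
    unfolding borel_prod[symmetric] by measurable
  have SX: "?S -` X \<in> sets borel"
    using measurable_sets[OF S X] by simp
  have "emeasure (distr lborel borel ?S) X = emeasure lborel (?S -` X)"
    using S X by (simp add: emeasure_distr)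
  also have "\<dots> = (\<integral>\<^sup>+x. emeasure lborel (Pair x -` (?S -` X)) \<partial>lborel)"
    using SX by (rule emeasure_lborel_Pair)
  also have "\<dots> = (\<integral>\<^sup>+x. emeasure lborel (Pair x -` X) \<partial>lborel)"
  proof (rule nn_integral_cong)
    fix x
    have meas: "Pair x -` X \<in> sets borel"
      using X by (metis borel_prod sets_Pair1)
    have "emeasure lborel (Pair x -` X) = emeasure (distr lborel borel ((+) (f x))) (Pair x -` X)"
      by (simp add: lborel_distr_plus)
    also have "\<dots> = emeasure lborel (Pair x -` (?S -` X))"
      using meas by (subst emeasure_distr) (auto intro!: arg_cong[where f="emeasure lborel"] simp: add.commute)
    finally show "emeasure lborel (Pair x -` (?S -` X)) = emeasure lborel (Pair x -` X)" ..
  qed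
  also have "\<dots> = emeasure lborel X"
    using X by (rule emeasure_lborel_Pair[symmetric])
  finally show "emeasure (distr lborel borel ?S) X = emeasure lborel X" .
qed simp

text \<open>Conjugation with the swap of coordinates, itself measure preserving, reduces this to the
  shear of the second coordinate.\<close>

lemma shear_fst_measure_preserving:
  fixes f :: "'b::euclidean_space \<Rightarrow> 'a::euclidean_space"
  assumes [measurable]: "f \<in> borel_measurable borel"
  shows "distr lborel borel (\<lambda>q. (fst q + f (snd q), snd q)) = (lborel :: ('a \<times> 'b) measure)"
proof -
  let ?S = "\<lambda>q::'b \<times> 'a. (fst q, snd q + f (fst q))"
  have swap: "distr lborel borel prod.swap = (lborel :: ('y::euclidean_space \<times> 'x::euclidean_space) measure)"
    by (rule sym, subst lborel_prod[symmetric], subst lborel_pair.distr_pair_swap)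
       (auto intro!: distr_cong simp: lborel_prod borel_prod split_beta)
  have [measurable]: "prod.swap \<in> (borel :: ('x::euclidean_space \<times> 'y::euclidean_space) measure) \<rightarrow>\<^sub>M borel"
    by (intro borel_measurable_continuous_onI continuous_on_swap)
  have [measurable]: "?S \<in> borel \<rightarrow>\<^sub>M borel"
    unfolding borel_prod[symmetric] by measurable
  have "(\<lambda>q. (fst q + f (snd q), snd q)) = prod.swap \<circ> (?S \<circ> prod.swap)"
    by auto
  hence "distr lborel borel (\<lambda>q. (fst q + f (snd q), snd q)) =
      distr (distr (distr lborel borel prod.swap) borel ?S) borel prod.swap"
    by (simp add: distr_distr del: o_apply)
  thus ?thesis
    by (simp add: swap shear_snd_measure_preserving)
qed

text \<open>
  The rotation taking \<open>(p, r)\<close> to \<open>(0, 1)\<close> is a product of three shears, the middle one along the last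
  axis and the outer ones with slope \<open>tan (\<theta> / 2) = |p| / (1 + r)\<close>, where \<open>\<theta>\<close> is the angle of rotation.
\<close>
lemma emeasure_ball_halfspace_rotate:
  fixes p :: "'a::euclidean_space" and r :: real
  assumes u: "(norm p)\<^sup>2 + r\<^sup>2 = 1" and r: "0 \<le> r"
  shows "emeasure lborel (cball 0 1 \<inter> {q. d \<le> (p, r) \<bullet> q}) =
         emeasure lborel (cball 0 1 \<inter> {q :: 'a \<times> real. d \<le> snd q})"
proof -
  define m where "m = p /\<^sub>R (1 + r)"
  define S1 :: "'a \<times> real \<Rightarrow> 'a \<times> real" where "S1 = (\<lambda>q. (fst q + (- snd q) *\<^sub>R m, snd q))"
  define S2 :: "'a \<times> real \<Rightarrow> 'a \<times> real" where "S2 = (\<lambda>q. (fst q, snd q + p \<bullet> fst q))"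
  have inv: "distr lborel borel S1 = lborel" "distr lborel borel S2 = lborel"
    unfolding S1_def S2_def
    by (rule shear_fst_measure_preserving shear_snd_measure_preserving, measurable)+
  have [measurable]: "S1 \<in> borel \<rightarrow>\<^sub>M borel" "S2 \<in> borel \<rightarrow>\<^sub>M borel"
    unfolding S1_def S2_def
    by (intro borel_measurable_continuous_onI continuous_intros)+
  have R: "distr lborel borel (S1 \<circ> (S2 \<circ> S1)) = lborel"
  proof -
    have "distr lborel borel (S1 \<circ> (S2 \<circ> S1)) =
        distr (distr (distr lborel borel S1) borel S2) borel S1"
      by (simp add: distr_distr del: o_apply)
    thus ?thesis by (simp add: inv)
  qed
  have p: "p = (1 + r) *\<^sub>R m" and pp: "p \<bullet> p = 1 - r\<^sup>2"
    using u r by (simp_all add: m_def power2_norm_eq_inner)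
  \<comment> \<open>The squared slope is \<open>(1 - r) / (1 + r)\<close>, the half-angle formula
    for the squared tangent, stated without a denominator.\<close>
  have mm: "(1 + r) * (m \<bullet> m) = 1 - r"
  proof -
    have "(1 + r) * ((1 + r) * (m \<bullet> m)) = (1 + r) * (1 - r)"
      using pp unfolding p by (simp add: algebra_simps power2_eq_square)
    thus ?thesis using r by simp
  qed
  have snd_R: "snd (S1 (S2 (S1 q))) = (p, r) \<bullet> q" for q
  proof -
    have "p \<bullet> m = 1 - r"
      using mm by (simp add: p)
    hence "snd q * (p \<bullet> m) = snd q - snd q * r"
      by (simp add: right_diff_distrib)
    thus ?thesis
      by (cases q) (simp add: S1_def S2_def inner_diff_right algebra_simps)
  qed
  have norm_R: "norm (S1 (S2 (S1 q))) = norm q" for q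
  proof -
    obtain x z where q: "q = (x, z)" by force
    define s where "s = m \<bullet> x"
    define t where "t = (1 + r) * s + r * z"
    define k where "k = m \<bullet> m"
    have fst_R: "fst (S1 (S2 (S1 q))) = x - (z + t) *\<^sub>R m"
      using snd_R[of q] by (simp add: S1_def S2_def q t_def s_def p scaleR_left_distrib
          inner_add_left distrib_right)
    \<comment> \<open>Multiplied by \<open>1 + r\<close>, every occurrence of \<open>k\<close> and
      \<open>s\<close> can be eliminated, through \<open>mm\<close> and the definition of
      \<open>t\<close>; the factor is nonzero and is cancelled afterwards.\<close>
    have "(1 + r) * ((z + t)\<^sup>2 * k + t\<^sup>2) = (1 + r) * (2 * (z + t) * s + z\<^sup>2)"
    proof -
      have "(1 + r) * ((z + t)\<^sup>2 * k + t\<^sup>2) = (z + t)\<^sup>2 * ((1 + r) * k) + (1 + r) * t\<^sup>2"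
        by (simp add: algebra_simps)
      also have "\<dots> = (z + t)\<^sup>2 * (1 - r) + (1 + r) * t\<^sup>2"
        using mm by (simp add: k_def)
      also have "\<dots> = 2 * (z + t) * ((1 + r) * s) + (1 + r) * z\<^sup>2"
        unfolding t_def by (simp add: algebra_simps power2_eq_square)
      finally show ?thesis by (simp add: algebra_simps)
    qed
    hence eq: "(z + t)\<^sup>2 * k + t\<^sup>2 = 2 * (z + t) * s + z\<^sup>2"
      using r by simp
    have "(norm (S1 (S2 (S1 q))))\<^sup>2 = (norm (x - (z + t) *\<^sub>R m))\<^sup>2 + t\<^sup>2"
      using fst_R snd_R[of q] by (simp add: norm_prod_def q t_def s_def p)
    also have "(norm (x - (z + t) *\<^sub>R m))\<^sup>2 = (norm x)\<^sup>2 - 2 * (z + t) * s + (z + t)\<^sup>2 * k"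
      unfolding s_def k_def power2_norm_eq_inner
      by (simp add: inner_diff_left inner_diff_right inner_commute power2_eq_square)
    also have "(norm x)\<^sup>2 - 2 * (z + t) * s + (z + t)\<^sup>2 * k + t\<^sup>2 = (norm q)\<^sup>2"
      using eq by (simp add: q norm_prod_def)
    finally show ?thesis by simp
  qed
  have "emeasure lborel (cball 0 1 \<inter> {q :: 'a \<times> real. d \<le> snd q}) =
        emeasure (distr lborel borel (S1 \<circ> (S2 \<circ> S1))) (cball 0 1 \<inter> {q. d \<le> snd q})"
    by (simp add: R)
  also have "\<dots> = emeasure lborel ((S1 \<circ> (S2 \<circ> S1)) -` (cball 0 1 \<inter> {q. d \<le> snd q}))"
    by (subst emeasure_distr) (auto intro!: borel_closed closed_Int closed_Collect_le continuous_intros)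
  also have "(S1 \<circ> (S2 \<circ> S1)) -` (cball 0 1 \<inter> {q. d \<le> snd q}) =
      cball 0 1 \<inter> {q. d \<le> (p, r) \<bullet> q}"
    by (rule set_eqI) (use norm_R snd_R in simp)
  finally show ?thesis ..
qed

section \<open>Volume of a cap of the unit ball\<close>

text \<open>The base vanishes at the endpoints -1 and 1, where continuity of \<open>powr\<close>
  rests on the exponent being positive.\<close>

lemma continuous_on_cap_integrand:
  assumes "A \<subseteq> {-1..1}" "0 < n"
  shows "continuous_on A (\<lambda>z::real. (1 - z\<^sup>2) powr (real n / 2))"
proof (rule continuous_on_powr')
  show "\<forall>z\<in>A. 0 \<le> 1 - z\<^sup>2 \<and> (1 - z\<^sup>2 = 0 \<longrightarrow> 0 < real n / 2)"
    using assms by (auto simp: abs_square_le_1 abs_le_iff)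
qed (intro continuous_intros)+

text \<open>The slice at height \<open>z\<close> is a ball of radius
  \<open>sqrt (1 - z\<^sup>2)\<close>; its volume is integrated over \<open>z\<close>. Negative
  \<open>d\<close> is included, so that parts larger than half of the ball are covered too.\<close>

lemma emeasure_ball_halfspace_snd:
  fixes d :: real
  assumes d: "- 1 \<le> d" "d \<le> 1"
  shows "emeasure lborel (cball 0 1 \<inter> {q :: 'a::euclidean_space \<times> real. d \<le> snd q}) = ennreal (L0 DIM('a) d)"
proof -
  let ?n = "real DIM('a)"
  let ?h = "\<lambda>z::real. (1 - z\<^sup>2) powr (?n / 2)"
  have slice: "emeasure lborel ((\<lambda>x. (x, z)) -` (cball 0 1 \<inter> {q :: 'a \<times> real. d \<le> snd q})) =
      ennreal (unit_ball_vol ?n) * (ennreal (?h z) * indicator {d..1} z)" for z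
  proof (cases "z \<in> {d..1}")
    case True
    hence z: "z\<^sup>2 \<le> 1"
      using d by (simp add: abs_square_le_1 abs_le_iff)
    have iff: "norm (x, z) \<le> 1 \<longleftrightarrow> norm x \<le> sqrt (1 - z\<^sup>2)" for x :: 'a
    proof -
      have "norm (x, z) \<le> 1 \<longleftrightarrow> (norm x)\<^sup>2 + z\<^sup>2 \<le> 1"
        by (simp add: norm_prod_def)
      also have "\<dots> \<longleftrightarrow> (norm x)\<^sup>2 \<le> 1 - z\<^sup>2" by linarith
      also have "\<dots> \<longleftrightarrow> norm x \<le> sqrt (1 - z\<^sup>2)"
        using z by (metis norm_ge_zero real_le_rsqrt real_sqrt_le_iff real_sqrt_abs abs_of_nonneg)
      finally show ?thesis .
    qed
    \<comment> \<open>At the poles both sides are 0; they are treated apart because the rule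
      relating \<open>powr\<close> to powers asks for a positive base.\<close>
    have pow: "sqrt (1 - z\<^sup>2) ^ DIM('a) = ?h z"
    proof (cases "z\<^sup>2 = 1")
      case False
      with z have "sqrt (1 - z\<^sup>2) ^ DIM('a) = ((1 - z\<^sup>2) powr (1/2)) powr ?n"
        by (subst powr_realpow) (simp_all add: powr_half_sqrt)
      thus ?thesis by (simp add: powr_powr)
    qed simp
    have "(\<lambda>x. (x, z)) -` (cball 0 1 \<inter> {q :: 'a \<times> real. d \<le> snd q}) = cball 0 (sqrt (1 - z\<^sup>2))"
      using True iff by auto
    thus ?thesis
      using True z by (simp add: emeasure_cball pow ennreal_mult)
  next
    case False
    have "\<not> norm (x, z) \<le> 1" if "d \<le> z" for x :: 'a
      using norm_snd_le[of z x] that False by auto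
    hence "(\<lambda>x. (x, z)) -` (cball 0 1 \<inter> {q :: 'a \<times> real. d \<le> snd q}) = {}"
      by auto
    thus ?thesis using False by simp
  qed
  have cont: "continuous_on {d..1} ?h"
    using d by (intro continuous_on_cap_integrand) auto
  have "emeasure lborel (cball 0 1 \<inter> {q :: 'a \<times> real. d \<le> snd q}) =
      (\<integral>\<^sup>+z. ennreal (unit_ball_vol ?n) * (ennreal (?h z) * indicator {d..1} z) \<partial>lborel)"
    unfolding slice[symmetric]
    by (intro emeasure_lborel_Pair(2) borel_closed closed_Int closed_Collect_le closed_cball continuous_intros)
  also have "\<dots> = ennreal (unit_ball_vol ?n) * (\<integral>\<^sup>+z\<in>{d..1}. ennreal (?h z) \<partial>lborel)"
    by (subst nn_integral_cmult) simp_all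
  also have "(\<integral>\<^sup>+z\<in>{d..1}. ennreal (?h z) \<partial>lborel) = ennreal (integral {d..1} ?h)"
    using cont
    by (intro nn_integral_has_integral_lebesgue' integrable_integral integrable_continuous_real) auto
  also have "ennreal (unit_ball_vol ?n) * ennreal (integral {d..1} ?h) = ennreal (L0 DIM('a) d)"
    by (subst ennreal_mult'[symmetric]) (simp_all add: L0_def unit_ball_vol_def)
  finally show ?thesis .
qed

text \<open>A direction with nonnegative last coordinate is rotated to the last axis; any other one
  is first reflected in the origin.\<close>

lemma emeasure_ball_halfspace:
  fixes u :: "'a::euclidean_space \<times> real" and d :: real
  assumes u: "norm u = 1" and d: "- 1 \<le> d" "d \<le> 1"
  shows "emeasure lborel (cball 0 1 \<inter> {q. d \<le> u \<bullet> q}) = ennreal (L0 DIM('a) d)"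
proof -
  have *: "emeasure lborel (cball 0 1 \<inter> {q. d \<le> v \<bullet> q}) = ennreal (L0 DIM('a) d)"
    if "norm v = 1" "0 \<le> snd v" for v :: "'a \<times> real"
    using emeasure_ball_halfspace_rotate[of "fst v" "snd v" d] emeasure_ball_halfspace_snd[OF d, where 'a='a] that
    by (auto simp: norm_prod_def split_beta real_sqrt_eq_1_iff)
  show ?thesis
  proof (cases "0 \<le> snd u")
    case False
    \<comment> \<open>The reflection has the shape \<open>t + c *\<^sub>R x\<close> of
      \<open>lborel_affine\<close>, whose density is 1 for \<open>c = -1\<close>.\<close>
    have refl: "(\<lambda>q. 0 + (-1::real) *\<^sub>R q) -` (cball 0 1 \<inter> {q. d \<le> u \<bullet> q}) = cball 0 1 \<inter> {q. d \<le> (- u) \<bullet> q}"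
      by (auto simp: norm_prod_def)
    have "emeasure lborel (cball 0 1 \<inter> {q. d \<le> u \<bullet> q}) =
        emeasure (distr lborel borel (\<lambda>q. 0 + (-1::real) *\<^sub>R q)) (cball 0 1 \<inter> {q. d \<le> u \<bullet> q})"
      by (subst lborel_affine[of "-1" 0]) (simp_all add: density_1)
    also have "\<dots> = emeasure lborel ((\<lambda>q. 0 + (-1::real) *\<^sub>R q) -` (cball 0 1 \<inter> {q. d \<le> u \<bullet> q}))"
      by (subst emeasure_distr) (auto intro!: borel_closed closed_Int closed_Collect_le continuous_intros)
    also have "\<dots> = ennreal (L0 DIM('a) d)"
      unfolding refl by (rule *) (use u False in auto)
    finally show ?thesis .
  qed (use * u in simp)
qed

text \<open>The difference is a positive multiple of the integral over \<open>{s..t}\<close> of a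
  nonnegative continuous function that is nonzero at the midpoint, a point strictly between -1 and
  1.\<close>

lemma L0_strict_decreasing:
  assumes "- 1 \<le> s" "s < t" "t \<le> 1" "0 < n"
  shows "L0 n t < L0 n s"
proof -
  let ?h = "\<lambda>z::real. (1 - z\<^sup>2) powr (real n / 2)"
  have cont: "continuous_on {s..1} ?h"
    using assms by (intro continuous_on_cap_integrand) auto
  have split: "integral {s..1} ?h = integral {s..t} ?h + integral {t..1} ?h"
    using assms cont
    by (subst Henstock_Kurzweil_Integration.integral_combine) (auto intro: integrable_continuous_real)
  have "integral {s..t} ?h \<noteq> 0"
  proof
    assume "integral {s..t} ?h = 0"
    moreover have "continuous_on {s..t} ?h"
      using cont assms by (auto intro: continuous_on_subset)
    ultimately have "\<forall>z\<in>{s..t}. ?h z = 0"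
      using assms by (subst (asm) integral_eq_0_iff) auto
    hence "((s + t) / 2)\<^sup>2 = 1"
      using assms by auto
    thus False
      using assms by (auto simp: power2_eq_1_iff)
  qed
  moreover have "0 \<le> integral {s..t} ?h"
    by (rule integral_nonneg) (use cont assms in \<open>auto intro!: integrable_continuous_real intro: continuous_on_subset\<close>)
  moreover have "0 < pi powr (real n / 2) / Gamma (real n / 2 + 1)"
    using Gamma_real_pos by (simp add: add_nonneg_pos)
  ultimately show ?thesis
    unfolding L0_def split by (intro mult_strict_left_mono) auto
qed

lemma L0_nonneg:
  assumes "- 1 \<le> t" "t \<le> 1" "0 < n"
  shows "0 \<le> L0 n t"
proof -
  have "L0 n 1 = 0"
    by (simp add: L0_def)
  thus ?thesis
    using L0_strict_decreasing[of t 1 n] assms by (cases "t = 1") auto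
qed

text \<open>The part \<open>v\<close> of \<open>u'\<close> orthogonal to \<open>u\<close> is a
  direction inside the hyperplane, so \<open>u'\<close> is orthogonal to \<open>v\<close> as well
  and \<open>v = 0\<close>. This compares the equation hidden in \<open>smaller_part_cut_off\<close>
  with a given one.\<close>

lemma hyperplane_eqD:
  fixes u u' :: "'a::real_inner"
  assumes eq: "{q. u \<bullet> q = b} = {q. u' \<bullet> q = b'}" and u: "u \<noteq> 0"
  obtains s where "u' = s *\<^sub>R u" "b' = s * b"
proof -
  define s where "s = (u \<bullet> u') / (u \<bullet> u)"
  define v where "v = u' - s *\<^sub>R u"
  define q0 where "q0 = (b / (u \<bullet> u)) *\<^sub>R u"
  have uv: "u \<bullet> v = 0"
    using u by (simp add: v_def s_def inner_diff_right)
  have "q0 \<in> {q. u \<bullet> q = b}" "q0 + v \<in> {q. u \<bullet> q = b}"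
    using u uv by (simp_all add: q0_def inner_add_right)
  hence q0: "u' \<bullet> q0 = b'" "u' \<bullet> v = 0"
    unfolding eq by (simp_all add: inner_add_right)
  have "v \<bullet> v = 0"
    using q0 uv by (simp add: v_def inner_diff_left)
  hence "u' = s *\<^sub>R u"
    by (simp add: v_def)
  moreover from this have "b' = s * b"
    using q0 u by (simp add: q0_def mult.commute)
  ultimately show ?thesis by (rule that)
qed

section \<open>The diagonal map and the volumes cut off from the ellipsoid\<close>

text \<open>The diagonal entries are parameters, so that the inverse map is again a
  \<open>stretch\<close>, with reciprocal entries.\<close>

definition stretch :: "real ^ 'n \<Rightarrow> real \<Rightarrow> (real ^ 'n) \<times> real \<Rightarrow> (real ^ 'n) \<times> real" where
  "stretch a c q = (\<chi> i. a $ i * fst q $ i, c * snd q)"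

lemma linear_stretch: "linear (stretch a c)"
  by (rule linearI) (simp_all add: stretch_def vec_eq_iff algebra_simps)

text \<open>A diagonal map is self-adjoint; this carries it over from the points of a half-space to
  its normal.\<close>

lemma inner_stretch: "u \<bullet> stretch a c q = stretch a c u \<bullet> q"
  by (simp add: stretch_def inner_prod_def inner_vec_def mult_ac)

text \<open>This is the form of a diagonal map in \<open>lborel_affine_euclidean\<close>, the
  leading 0 being the translation.\<close>

lemma stretch_eq_sum_Basis:
  fixes a :: "real ^ 'n" and c :: real
  shows "stretch a c q = 0 + (\<Sum>j\<in>Basis. (((a, c) \<bullet> j) * (q \<bullet> j)) *\<^sub>R j)"
proof (rule euclidean_eqI)
  fix j :: "(real ^ 'n) \<times> real" assume j: "j \<in> Basis"
  hence "stretch a c q \<bullet> j = ((a, c) \<bullet> j) * (q \<bullet> j)"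
    by (cases q) (auto simp: Basis_prod_def Basis_vec_def stretch_def inner_axis)
  thus "stretch a c q \<bullet> j = (0 + (\<Sum>j\<in>Basis. (((a, c) \<bullet> j) * (q \<bullet> j)) *\<^sub>R j)) \<bullet> j"
    using j by (simp add: inner_sum_left_Basis)
qed

lemma prod_Basis_vec_prod:
  fixes f :: "(real ^ 'n) \<times> real \<Rightarrow> real"
  shows "(\<Prod>j\<in>Basis. f j) = (\<Prod>i\<in>UNIV. f (axis i 1, 0)) * f (0, 1)"
proof -
  have B: "(Basis :: ((real ^ 'n) \<times> real) set) = insert (0, 1) (range (\<lambda>i. (axis i 1, 0)))"
    by (auto simp: Basis_prod_def Basis_vec_def)
  show ?thesis
    unfolding B by (subst prod.insert) (auto simp: axis_eq_axis prod.reindex inj_on_def mult.commute)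
qed

locale ellipsoid =
  fixes a :: "real ^ 'n" and c :: real
  assumes a_pos: "a $ i > 0" and c_pos: "c > 0"
begin

abbreviation T :: "(real ^ 'n) \<times> real \<Rightarrow> (real ^ 'n) \<times> real" where
  "T \<equiv> stretch a c"

abbreviation T' :: "(real ^ 'n) \<times> real \<Rightarrow> (real ^ 'n) \<times> real" where
  "T' \<equiv> stretch (\<chi> i. inverse (a $ i)) (inverse c)"

lemma T_T' [simp]: "T (T' q) = q" and T'_T [simp]: "T' (T q) = q"
  using a_pos c_pos by (simp_all add: stretch_def vec_eq_iff prod_eq_iff less_imp_neq[symmetric])

lemma T_eq_0_iff [simp]: "T q = 0 \<longleftrightarrow> q = 0"
  by (metis T'_T linear_0 linear_stretch)

lemma ell_eq: "ell a c q = (norm (T' q))\<^sup>2"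
proof -
  have "ell a c q = (\<Sum>i\<in>UNIV. (inverse (a $ i) * fst q $ i)\<^sup>2) + (inverse c * snd q)\<^sup>2"
    by (simp add: ell_def divide_inverse power_mult_distrib power_inverse mult.commute)
  also have "\<dots> = (norm (T' q))\<^sup>2"
    unfolding power2_norm_eq_inner stretch_def
    by (simp add: inner_prod_def inner_vec_def power2_eq_square)
  finally show ?thesis .
qed

lemma ell_le_power2_iff: "0 \<le> r \<Longrightarrow> ell a c q \<le> r\<^sup>2 \<longleftrightarrow> norm (T' q) \<le> r"
  by (simp add: ell_eq abs_le_square_iff[symmetric])

text \<open>Self-adjointness gives \<open>u \<bullet> q = T u \<bullet> T' q\<close>. Thus
  \<open>norm (T u)\<close> bounds the linear form \<open>u\<close> on the solid ellipsoid, where it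
  is in fact the support function.\<close>

lemma inner_le_norm_T: "u \<bullet> q \<le> norm (T u) * norm (T' q)"
  using norm_cauchy_schwarz[of "T u" "T' q"] by (simp flip: inner_stretch)

lemma continuous_on_ell: "continuous_on A (ell a c)"
  unfolding ell_def by (intro continuous_intros) (use a_pos c_pos in \<open>auto simp: less_imp_neq[symmetric]\<close>)

lemma compact_ell_le: "compact {q. ell a c q \<le> 1}"
proof -
  have "{q. ell a c q \<le> 1} = T ` cball 0 1"
  proof safe
    fix q assume "ell a c q \<le> 1"
    thus "q \<in> T ` cball 0 1"
      using ell_le_power2_iff[of 1 q] by (intro image_eqI[of _ _ "T' q"]) simp_all
  qed (use ell_le_power2_iff[of 1] in auto)
  thus ?thesis
    by (simp add: compact_continuous_image linear_continuous_on linear_linear linear_stretch)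
qed

lemma emeasure_stretch:
  assumes X: "X \<in> sets borel"
  shows "emeasure lborel X = ennreal ((\<Prod>i\<in>UNIV. a $ i) * c) * emeasure lborel (T -` X)"
proof -
  have nz: "(a, c) \<bullet> j \<noteq> 0" if "j \<in> Basis" for j
    using that a_pos c_pos by (auto simp: Basis_prod_def Basis_vec_def inner_axis less_imp_neq[symmetric])
  have prod: "(\<Prod>j\<in>Basis. \<bar>(a, c) \<bullet> j\<bar>) = (\<Prod>i\<in>UNIV. a $ i) * c"
    unfolding prod_Basis_vec_prod using a_pos c_pos by (simp add: inner_axis abs_of_pos)
  have T: "T \<in> borel \<rightarrow>\<^sub>M borel"
    by (intro borel_measurable_continuous_onI linear_continuous_on linear_stretch[THEN linear_conv_bounded_linear[THEN iffD1]])
  have "lborel = density (distr lborel borel T) (\<lambda>_. ennreal ((\<Prod>i\<in>UNIV. a $ i) * c))"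
    using lborel_affine_euclidean[of "\<lambda>j. (a, c) \<bullet> j" 0, OF nz]
    unfolding stretch_eq_sum_Basis[symmetric, abs_def] prod by simp
  hence "emeasure lborel X = emeasure (density (distr lborel borel T) (\<lambda>_. ennreal ((\<Prod>i\<in>UNIV. a $ i) * c))) X"
    by simp
  also have "\<dots> = ennreal ((\<Prod>i\<in>UNIV. a $ i) * c) * emeasure lborel (T -` X)"
    using X T by (simp add: emeasure_density nn_integral_cmult_indicator emeasure_distr)
  finally show ?thesis .
qed

text \<open>The bound on \<open>b\<close> says that the hyperplane meets the solid, so that
  \<open>b / norm (T u)\<close> lies in the range of the cap formula.\<close>

lemma measure_halfspace:
  assumes u: "u \<noteq> 0" and b: "\<bar>b\<bar> \<le> norm (T u)"
  shows "measure lebesgue ({q. ell a c q \<le> 1} \<inter> {q. b \<le> u \<bullet> q}) = L a c (b / norm (T u))"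
proof -
  let ?X = "{q. ell a c q \<le> 1} \<inter> {q. b \<le> u \<bullet> q}"
  let ?N = "norm (T u)" and ?D = "(\<Prod>i\<in>UNIV. a $ i) * c"
  have N: "?N > 0" using u by simp
  have D: "?D > 0" using a_pos c_pos by (simp add: prod_pos)
  have bN: "- 1 \<le> b / ?N" "b / ?N \<le> 1"
    using b N by (auto simp: field_simps)
  have X: "?X \<in> sets borel"
    by (intro borel_closed closed_Int compact_imp_closed[OF compact_ell_le] closed_Collect_le continuous_intros)
  have "T -` ?X = cball 0 1 \<inter> {q. b / ?N \<le> (T u /\<^sub>R ?N) \<bullet> q}"
  proof (rule set_eqI)
    fix q
    have "b / ?N \<le> (T u /\<^sub>R ?N) \<bullet> q \<longleftrightarrow> b \<le> u \<bullet> T q"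
      using N by (simp add: inner_stretch divide_le_cancel flip: divide_inverse_commute)
    thus "q \<in> T -` ?X \<longleftrightarrow> q \<in> cball 0 1 \<inter> {q. b / ?N \<le> (T u /\<^sub>R ?N) \<bullet> q}"
      using ell_le_power2_iff[of 1 "T q"] by simp
  qed
  hence "emeasure lborel ?X = ennreal ?D * ennreal (L0 CARD('n) (b / ?N))"
    using emeasure_ball_halfspace[of "T u /\<^sub>R ?N" "b / ?N"] N bN
    by (subst emeasure_stretch[OF X]) simp
  also have "\<dots> = ennreal (L a c (b / ?N))"
    using D by (simp add: L_def ennreal_mult')
  finally show ?thesis
    using X D bN by (simp add: measure_completion measure_def L_def L0_nonneg)
qed

lemma L_strict_decreasing: "- 1 \<le> s \<Longrightarrow> s < t \<Longrightarrow> t \<le> 1 \<Longrightarrow> L a c t < L a c s"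
  unfolding L_def using a_pos c_pos
  by (intro mult_strict_left_mono L0_strict_decreasing) (auto intro!: mult_pos_pos prod_pos)

lemma L_le_iff: "s \<in> {-1..1} \<Longrightarrow> t \<in> {-1..1} \<Longrightarrow> L a c s \<le> L a c t \<longleftrightarrow> t \<le> s"
  using L_strict_decreasing[of s t] L_strict_decreasing[of t s] by (cases s t rule: linorder_cases) auto

lemma inj_on_L: "inj_on (L a c) {-1..1}"
  by (rule inj_onI) (metis L_le_iff order_refl antisym)

text \<open>Rescaling the equation of the hyperplane leaves
  \<open>\<bar>b\<bar> / norm (T u)\<close> unchanged, and since \<open>L\<close> decreases, the
  smaller part is the one whose signed distance is nonnegative.\<close>

lemma smaller_part_measure:
  assumes u: "u \<noteq> 0" and b: "\<bar>b\<bar> \<le> norm (T u)"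
    and S: "smaller_part_cut_off {q. ell a c q \<le> 1} {q. u \<bullet> q = b} S"
  shows "compact S" "measure lebesgue S = L a c (\<bar>b\<bar> / norm (T u))"
proof -
  obtain v d where v: "v \<noteq> 0" and H: "{q. u \<bullet> q = b} = {q. v \<bullet> q = d}"
    and S_eq: "S = {q. ell a c q \<le> 1} \<inter> {q. v \<bullet> q \<le> d}"
    and le: "measure lebesgue S \<le> measure lebesgue ({q. ell a c q \<le> 1} \<inter> {q. v \<bullet> q \<ge> d})"
    using S unfolding smaller_part_cut_off_def by blast
  obtain s where s: "v = s *\<^sub>R u" "d = s * b"
    using hyperplane_eqD[OF H u] by blast
  have s0: "s \<noteq> 0" using v s by auto
  have Tv: "norm (T v) = \<bar>s\<bar> * norm (T u)"
    by (simp add: s linear_cmul[OF linear_stretch])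
  have abs_d: "\<bar>d\<bar> = \<bar>s\<bar> * \<bar>b\<bar>"
    by (simp add: s abs_mult)
  have d: "\<bar>d\<bar> \<le> norm (T v)" and quot: "\<bar>d\<bar> / norm (T v) = \<bar>b\<bar> / norm (T u)"
    using b s0 by (simp_all add: Tv abs_d mult_left_mono)
  define x where "x = d / norm (T v)"
  have x: "x \<in> {-1..1}" "- x \<in> {-1..1}"
    using d v by (auto simp: x_def field_simps)
  have "S = {q. ell a c q \<le> 1} \<inter> {q. - d \<le> (- v) \<bullet> q}"
    by (auto simp: S_eq)
  hence meas: "measure lebesgue S = L a c (- x)"
    using measure_halfspace[of "- v" "- d"] v d by (simp add: x_def linear_neg[OF linear_stretch])
  with le have "L a c (- x) \<le> L a c x"
    using measure_halfspace[of v d] v d by (simp add: x_def)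
  \<comment> \<open>Monotonicity turns the comparison of volumes into \<open>x \<le> - x\<close>;
    equal volumes correspond to \<open>x = 0\<close>.\<close>
  hence "- x = \<bar>x\<bar>"
    using L_le_iff[OF x(2,1)] by linarith
  with meas show "measure lebesgue S = L a c (\<bar>b\<bar> / norm (T u))"
    by (simp add: x_def flip: quot)
  show "compact S"
    unfolding S_eq by (intro compact_Int_closed compact_ell_le closed_Collect_le continuous_intros)
qed

end

text \<open>One of the two sides is not larger than the other, and negating the equation exchanges
  them.\<close>

lemma ex_smaller_part_cut_off:
  assumes "u \<noteq> 0"
  shows "\<exists>S. smaller_part_cut_off K {q. u \<bullet> q = b} S"
proof -
  have "smaller_part_cut_off K {q. u \<bullet> q = b} (K \<inter> {q. u \<bullet> q \<le> b}) \<or>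
      smaller_part_cut_off K {q. u \<bullet> q = b} (K \<inter> {q. - u \<bullet> q \<le> - b})"
  proof (cases "measure lebesgue (K \<inter> {q. u \<bullet> q \<le> b}) \<le> measure lebesgue (K \<inter> {q. u \<bullet> q \<ge> b})")
    case True
    thus ?thesis
      using assms unfolding smaller_part_cut_off_def by blast
  next
    case False
    hence "- u \<noteq> 0 \<and> {q. u \<bullet> q = b} = {q. - u \<bullet> q = - b} \<and>
        measure lebesgue (K \<inter> {q. - u \<bullet> q \<le> - b}) \<le> measure lebesgue (K \<inter> {q. - u \<bullet> q \<ge> - b})"
      using assms by simp
    thus ?thesis
      unfolding smaller_part_cut_off_def by blast
  qed
  thus ?thesis by blast
qed

text \<open>
  If \<open>D v = 0\<close> and \<open>u \<bullet> v > 0\<close>, the function \<open>\<phi>\<close> changes sign on a short segment through \<open>p + t v\<close>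
  transversal to its zero set; the zero found there violates maximality of \<open>u \<bullet> p\<close>.
\<close>
lemma derivative_parallel_to_support_direction:
  fixes \<phi> :: "'a::euclidean_space \<Rightarrow> real"
  assumes A: "open A" "p \<in> A" and cont: "continuous_on A \<phi>"
    and D: "(\<phi> has_derivative D) (at p)" "D w \<noteq> 0"
    and u: "u \<noteq> 0" and p: "\<phi> p = 0"
    and supp: "\<And>q. q \<in> A \<Longrightarrow> \<phi> q = 0 \<Longrightarrow> u \<bullet> q \<le> u \<bullet> p"
  shows "D x = 0 \<longleftrightarrow> u \<bullet> x = 0"
proof -
  interpret D: bounded_linear D
    by (rule has_derivative_bounded_linear[OF D(1)])
  obtain w' where w': "D w' > 0"
    using D(2) D.neg[of w] by (metis linorder_neqE neg_0_less_iff_less)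
  have line: "((\<lambda>t. \<phi> (p + t *\<^sub>R y)) has_real_derivative D y) (at 0)" for y
  proof -
    have "((\<lambda>t. \<phi> (p + t *\<^sub>R y)) has_derivative (\<lambda>t. D (t *\<^sub>R y))) (at 0)"
      by (rule has_derivative_compose[of "\<lambda>t. p + t *\<^sub>R y" _ 0 UNIV \<phi> D])
         (auto intro!: derivative_eq_intros simp: D)
    thus ?thesis
      by (simp add: has_field_derivative_def D.scaleR mult_commute_abs)
  qed
  have ker_le: "u \<bullet> v \<le> 0" if v: "D v = 0" for v
  proof (rule ccontr)
    assume "\<not> u \<bullet> v \<le> 0"
    hence uv: "u \<bullet> v > 0" by simp
    \<comment> \<open>Tilting \<open>v\<close> by at most \<open>e\<close> in the direction
      \<open>w'\<close> changes its product with \<open>u\<close> by less than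
      \<open>u \<bullet> v\<close>, so all tilted directions still increase
      \<open>u\<close>.\<close>
    define e where "e = (u \<bullet> v) / (2 * (\<bar>u \<bullet> w'\<bar> + 1))"
    have e: "e > 0" and ew: "e * \<bar>u \<bullet> w'\<bar> < u \<bullet> v"
    proof -
      show "e > 0" using uv by (simp add: e_def)
      have "e * \<bar>u \<bullet> w'\<bar> < e * (2 * (\<bar>u \<bullet> w'\<bar> + 1))"
        using \<open>e > 0\<close> by (intro mult_strict_left_mono) auto
      also have "\<dots> = u \<bullet> v" by (simp add: e_def)
      finally show "e * \<bar>u \<bullet> w'\<bar> < u \<bullet> v" .
    qed
    have pos: "0 < D (v + e *\<^sub>R w')" and neg: "D (v + (- e) *\<^sub>R w') < 0"
      using e w' v by (simp_all add: D.add D.diff D.scaleR)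
    obtain d1 where d1: "d1 > 0" "\<And>t. 0 < t \<Longrightarrow> t < d1 \<Longrightarrow> 0 < \<phi> (p + t *\<^sub>R (v + e *\<^sub>R w'))"
      using DERIV_pos_inc_right[OF line pos] p by auto
    obtain d2 where d2: "d2 > 0" "\<And>t. 0 < t \<Longrightarrow> t < d2 \<Longrightarrow> \<phi> (p + t *\<^sub>R (v + (- e) *\<^sub>R w')) < 0"
      using DERIV_neg_dec_right[OF line neg] p by auto
    obtain r where r: "r > 0" "ball p r \<subseteq> A"
      using A open_contains_ball by blast
    \<comment> \<open>A strict bound for the norms of all tilted directions;
      \<open>t < r / B\<close> keeps the whole transversal segment inside \<open>A\<close>.\<close>
    define B where "B = norm v + e * norm w' + 1"
    have B: "B > 0" using e by (simp add: B_def add_nonneg_pos)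
    have "0 < min d1 (min d2 (r / B))"
      using d1(1) d2(1) r(1) B by simp
    then obtain t where t: "0 < t" "t < d1" "t < d2" "t < r / B"
      using dense by (metis min_less_iff_conj)
    have inA: "p + t *\<^sub>R (v + s *\<^sub>R w') \<in> A" if "s \<in> {- e..e}" for s
    proof -
      have "norm (v + s *\<^sub>R w') \<le> norm v + \<bar>s\<bar> * norm w'"
        by (metis norm_triangle_ineq norm_scaleR)
      also have "\<dots> \<le> norm v + e * norm w'"
        using that by (intro add_left_mono mult_right_mono) auto
      also have "\<dots> < B" by (simp add: B_def)
      finally have "t * norm (v + s *\<^sub>R w') < t * B"
        using t by simp
      also have "\<dots> < r" using t B by (simp add: field_simps)
      finally show ?thesis
        using r t by (auto simp: dist_norm)
    qed
    have "continuous_on {- e..e} (\<lambda>s. \<phi> (p + t *\<^sub>R (v + s *\<^sub>R w')))"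
      by (rule continuous_on_compose2[OF cont]) (auto intro!: continuous_intros inA)
    then obtain s where s: "- e \<le> s" "s \<le> e" "\<phi> (p + t *\<^sub>R (v + s *\<^sub>R w')) = 0"
      using IVT'[of "\<lambda>s. \<phi> (p + t *\<^sub>R (v + s *\<^sub>R w'))" "- e" 0 e] d1(2)[of t] d2(2)[of t] t e by auto
    have "t * (u \<bullet> v + s * (u \<bullet> w')) \<le> 0"
      using supp[OF inA s(3)] s by (simp add: inner_add_right)
    hence "u \<bullet> v + s * (u \<bullet> w') \<le> 0"
      using t by (simp add: mult_le_0_iff)
    moreover have "\<bar>s * (u \<bullet> w')\<bar> \<le> e * \<bar>u \<bullet> w'\<bar>"
      unfolding abs_mult using s by (intro mult_right_mono) auto
    ultimately show False using ew by linarith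
  qed
  have ker: "u \<bullet> v = 0" if "D v = 0" for v
    using ker_le[of v] ker_le[of "- v"] that by (simp add: D.neg)
  have Du: "D u \<noteq> 0"
    using ker[of u] u by auto
  \<comment> \<open>Subtracting a multiple of \<open>u\<close> moves \<open>x\<close> into the
    kernel of \<open>D\<close>, which shows that \<open>u \<bullet> x\<close> is a nonzero multiple
    of \<open>D x\<close>.\<close>
  have "u \<bullet> (x - (D x / D u) *\<^sub>R u) = 0"
    by (rule ker) (use Du in \<open>simp add: D.diff D.scaleR\<close>)
  hence "u \<bullet> x = (D x / D u) * (u \<bullet> u)"
    by (simp add: inner_diff_right)
  thus ?thesis using u Du by simp
qed

section \<open>Defining functions, boundary points and tangent hyperplanes\<close>

lemma C2_onE:
  assumes "C2_on A g"
  obtains g' :: "'a::real_normed_vector \<Rightarrow> 'a \<Rightarrow>\<^sub>L real"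
  where "\<forall>p\<in>A. (g has_derivative blinfun_apply (g' p)) (at p)" "continuous_on A g'" "continuous_on A g"
proof -
  obtain g' :: "'a \<Rightarrow> 'a \<Rightarrow>\<^sub>L real" and g''
    where g': "\<forall>p\<in>A. (g has_derivative blinfun_apply (g' p)) (at p)"
      and g'': "\<forall>p\<in>A. (g' has_derivative blinfun_apply (g'' p)) (at p)"
    using assms unfolding C2_on_def by blast
  show ?thesis
  proof
    show "continuous_on A g'" "continuous_on A g"
      using g' g'' by (meson continuous_at_imp_continuous_on has_derivative_continuous)+
  qed (rule g')
qed

lemma C2_defining_function_derivative_nonzero:
  assumes "C2_defining_function A g M" "p \<in> M"
  obtains w where "frechet_derivative g (at p) w \<noteq> 0"
proof (rule ccontr)
  assume "\<not> thesis"
  with that have "frechet_derivative g (at p) w = 0" for w by blast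
  with assms show False
    unfolding C2_defining_function_def by auto
qed

text \<open>From an interior point a short step along \<open>u\<close> would stay in
  \<open>K\<close> and increase the linear form.\<close>

lemma linear_maximum_in_frontier:
  fixes u :: "'a::real_inner"
  assumes "p \<in> K" "u \<noteq> 0" "\<And>q. q \<in> K \<Longrightarrow> u \<bullet> q \<le> u \<bullet> p"
  shows "p \<in> frontier K"
proof -
  have "p \<notin> interior K"
  proof
    assume "p \<in> interior K"
    then obtain e where e: "e > 0" "ball p e \<subseteq> K"
      using mem_interior by blast
    define t where "t = e / (2 * norm u)"
    have t: "t > 0" "t * norm u < e"
      using e assms(2) by (simp_all add: t_def)
    hence "p + t *\<^sub>R u \<in> K"
      using e by (auto simp: dist_norm)
    hence "t * (u \<bullet> u) \<le> 0"
      using assms(3) by (fastforce simp: inner_add_right)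
    moreover have "t * (u \<bullet> u) > 0" using t assms(2) by simp
    ultimately show False by linarith
  qed
  thus ?thesis
    using assms(1) closure_subset by (auto simp: frontier_def)
qed

context ellipsoid
begin

text \<open>\<open>T' (T' p)\<close> is half the gradient of \<open>ell\<close> at \<open>p\<close>,
  so it serves as the normal of the ellipsoid through \<open>p\<close>.\<close>

lemma inner_normal: "T' (T' p) \<bullet> q = T' p \<bullet> T' q"
  by (simp add: inner_stretch)

lemma mem_image_T_iff: "q \<in> T ` X \<longleftrightarrow> T' q \<in> X"
proof
  assume "T' q \<in> X"
  hence "T (T' q) \<in> T ` X" by (rule imageI)
  thus "q \<in> T ` X" by simp
qed auto

text \<open>The solid is the image of a ball under the injective linear map \<open>T\<close>, which
  commutes with taking interiors.\<close>

lemma frontier_ell_le: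
  assumes k: "0 < k"
  shows "frontier {q. ell a c q \<le> k\<^sup>2} = {q. ell a c q = k\<^sup>2}"
proof -
  have inj: "inj T" by (metis T'_T injI)
  have K: "{q. ell a c q \<le> k\<^sup>2} = T ` cball 0 k"
  proof (rule set_eqI)
    fix q show "q \<in> {q. ell a c q \<le> k\<^sup>2} \<longleftrightarrow> q \<in> T ` cball 0 k"
      using k by (simp add: ell_le_power2_iff mem_image_T_iff)
  qed
  have "interior {q. ell a c q \<le> k\<^sup>2} = T ` ball 0 k"
    unfolding K by (simp add: interior_injective_linear_image[OF linear_stretch inj])
  also have "\<dots> = {q. ell a c q < k\<^sup>2}"
  proof (rule set_eqI)
    fix q
    have "ell a c q < k\<^sup>2 \<longleftrightarrow> norm (T' q) < k"
      using k ell_le_power2_iff[of k q] by (auto simp: ell_eq less_le)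
    thus "q \<in> T ` ball 0 k \<longleftrightarrow> q \<in> {q. ell a c q < k\<^sup>2}"
      by (simp add: mem_image_T_iff)
  qed
  finally have int: "interior {q. ell a c q \<le> k\<^sup>2} = {q. ell a c q < k\<^sup>2}" .
  have "closed {q. ell a c q \<le> k\<^sup>2}"
    by (intro closed_Collect_le continuous_on_ell continuous_intros)
  thus ?thesis
    unfolding frontier_def int by auto
qed

lemma ell_has_derivative: "(ell a c has_derivative (\<lambda>x. 2 * (T' (T' p) \<bullet> x))) (at p)"
proof -
  have bl: "bounded_linear T'"
    using linear_stretch by (rule linear_conv_bounded_linear[THEN iffD1])
  have "((\<lambda>q. T' q \<bullet> T' q) has_derivative (\<lambda>x. T' p \<bullet> T' x + T' x \<bullet> T' p)) (at p)"
    by (intro has_derivative_inner bounded_linear_imp_has_derivative bl)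
  thus ?thesis
    unfolding ell_eq[abs_def] power2_norm_eq_inner inner_normal
    by (simp add: inner_commute)
qed

lemma tangent_hyperplane_ell:
  assumes "H \<in> tangent_hyperplanes UNIV (\<lambda>q. ell a c q - r)"
  obtains p where "ell a c p = r" "H = {q. T' (T' p) \<bullet> q = r}"
proof -
  obtain p where p: "ell a c p = r" and H: "H = {q. frechet_derivative (\<lambda>q. ell a c q - r) (at p) (q - p) = 0}"
    using assms unfolding tangent_hyperplanes_def by auto
  have "((\<lambda>q. ell a c q - r) has_derivative (\<lambda>x. 2 * (T' (T' p) \<bullet> x))) (at p)"
    by (rule has_derivative_eq_rhs[OF has_derivative_diff[OF ell_has_derivative has_derivative_const]]) simp
  hence "frechet_derivative (\<lambda>q. ell a c q - r) (at p) = (\<lambda>x. 2 * (T' (T' p) \<bullet> x))"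
    by (rule frechet_derivative_at[symmetric])
  hence "H = {q. T' (T' p) \<bullet> q = T' (T' p) \<bullet> p}"
    unfolding H by (simp add: inner_diff_right)
  with p show ?thesis
    by (intro that) (simp_all add: ell_eq power2_norm_eq_inner inner_normal)
qed

text \<open>The normal \<open>u = T' (T' p)\<close> satisfies
  \<open>norm (T u) = norm (T' p) = k\<close>, and the constant term is \<open>k\<^sup>2\<close>;
  the normalized distance is therefore \<open>k\<close>.\<close>

lemma cut_off_by_tangent_hyperplane_ell:
  assumes k: "0 < k" "k < 1" and H: "H \<in> tangent_hyperplanes UNIV (\<lambda>q. ell a c q - k\<^sup>2)"
  shows "\<exists>S. smaller_part_cut_off {q. ell a c q \<le> 1} H S"
    and "smaller_part_cut_off {q. ell a c q \<le> 1} H S \<Longrightarrow> compact S \<and> measure lebesgue S = L a c k"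
proof -
  obtain p where p: "ell a c p = k\<^sup>2" and H: "H = {q. T' (T' p) \<bullet> q = k\<^sup>2}"
    using H by (rule tangent_hyperplane_ell)
  have N: "norm (T (T' (T' p))) = k"
    using p k by (simp add: ell_eq)
  hence nz: "T' (T' p) \<noteq> 0" using k by (metis T_eq_0_iff less_irrefl norm_zero)
  show "\<exists>S. smaller_part_cut_off {q. ell a c q \<le> 1} H S"
    unfolding H using nz by (rule ex_smaller_part_cut_off)
  have le: "\<bar>k\<^sup>2\<bar> \<le> norm (T (T' (T' p)))"
    unfolding N using k by (simp add: power2_eq_square mult_left_le)
  have quot: "\<bar>k\<^sup>2\<bar> / norm (T (T' (T' p))) = k"
    unfolding N using k by (simp add: power2_eq_square)
  show "compact S \<and> measure lebesgue S = L a c k" if "smaller_part_cut_off {q. ell a c q \<le> 1} H S"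
    using smaller_part_measure[OF nz le that[unfolded H]] unfolding quot by blast
qed

section \<open>Recovering the convex body from its support function\<close>

lemma constant_cut_off_imp_ellipsoid:
  assumes K: "compact K" "convex K" "interior K \<noteq> {}"
    and \<phi>: "C2_defining_function A \<phi> (frontier K)"
    and inside: "frontier K \<subseteq> {q. ell a c q < 1}"
    and V: "\<And>H S. H \<in> tangent_hyperplanes A \<phi> \<Longrightarrow>
      smaller_part_cut_off {q. ell a c q \<le> 1} H S \<Longrightarrow> measure lebesgue S = V"
  obtains k where "0 < k" "k < 1" "V = L a c k" "K = {q. ell a c q \<le> k\<^sup>2}"
proof -
  have A: "open A" and C2: "C2_on A \<phi>" and M: "frontier K = {p \<in> A. \<phi> p = 0}"
    using \<phi> by (auto simp: C2_defining_function_def)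
  obtain \<phi>' where \<phi>': "\<forall>p\<in>A. (\<phi> has_derivative blinfun_apply (\<phi>' p)) (at p)"
    and "continuous_on A \<phi>'" and cont: "continuous_on A \<phi>"
    using C2 by (rule C2_onE)
  have K_ne: "K \<noteq> {}" using K(3) interior_subset by blast
  have closed: "closed K" using K(1) by (rule compact_imp_closed)
  have "\<exists>p. p \<in> K \<and> (\<forall>q\<in>K. u \<bullet> q \<le> u \<bullet> p) \<and> \<bar>u \<bullet> p\<bar> < norm (T u) \<and> V = L a c (\<bar>u \<bullet> p\<bar> / norm (T u))"
    if u: "u \<noteq> 0" for u
  proof -
    obtain p where p: "p \<in> K" and max: "\<And>q. q \<in> K \<Longrightarrow> u \<bullet> q \<le> u \<bullet> p"
      using continuous_attains_sup[OF K(1) K_ne continuous_on_inner[OF continuous_on_const continuous_on_id]]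
      by blast
    have pM: "p \<in> frontier K"
      using p u max by (rule linear_maximum_in_frontier)
    hence pA: "p \<in> A" "\<phi> p = 0" by (auto simp: M)
    obtain w where "frechet_derivative \<phi> (at p) w \<noteq> 0"
      using \<phi> pM by (rule C2_defining_function_derivative_nonzero)
    hence w: "\<phi>' p w \<noteq> 0"
      by (simp flip: frechet_derivative_at[OF bspec[OF \<phi>' pA(1)]])
    have "u \<bullet> q \<le> u \<bullet> p" if "q \<in> A" "\<phi> q = 0" for q
      using that M closed frontier_subset_closed by (intro max) blast
    hence "\<phi>' p x = 0 \<longleftrightarrow> u \<bullet> x = 0" for x
      by (intro derivative_parallel_to_support_direction[OF A pA(1) cont bspec[OF \<phi>' pA(1)] w u pA(2)])
    hence "{q. frechet_derivative \<phi> (at p) (q - p) = 0} = {q. u \<bullet> q = u \<bullet> p}"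
      by (simp add: inner_diff_right flip: frechet_derivative_at[OF bspec[OF \<phi>' pA(1)]])
    hence H: "{q. u \<bullet> q = u \<bullet> p} \<in> tangent_hyperplanes A \<phi>"
      using pA unfolding tangent_hyperplanes_def by blast
    \<comment> \<open>Lying strictly inside the ellipsoid makes the distance ratio less than 1; this
      yields \<open>k < 1\<close> below.\<close>
    have "norm (T' p) < 1"
      using pM inside by (auto simp: ell_eq abs_square_less_1)
    hence "norm (T u) * norm (T' p) < norm (T u) * 1"
      using u by (intro mult_strict_left_mono) auto
    moreover have "\<bar>u \<bullet> p\<bar> \<le> norm (T u) * norm (T' p)"
      using Cauchy_Schwarz_ineq2[of "T u" "T' p"] by (simp flip: inner_stretch)
    ultimately have lt: "\<bar>u \<bullet> p\<bar> < norm (T u)" by simp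
    obtain S where S: "smaller_part_cut_off {q. ell a c q \<le> 1} {q. u \<bullet> q = u \<bullet> p} S"
      using ex_smaller_part_cut_off[OF u] by blast
    have "V = L a c (\<bar>u \<bullet> p\<bar> / norm (T u))"
      using V[OF H S] smaller_part_measure(2)[OF u less_imp_le[OF lt] S] by simp
    with p max lt show ?thesis by blast
  qed
  then obtain P where P: "\<And>u. u \<noteq> 0 \<Longrightarrow> P u \<in> K"
    and max: "\<And>u q. u \<noteq> 0 \<Longrightarrow> q \<in> K \<Longrightarrow> u \<bullet> q \<le> u \<bullet> P u"
    and lt: "\<And>u. u \<noteq> 0 \<Longrightarrow> \<bar>u \<bullet> P u\<bar> < norm (T u)"
    and VP: "\<And>u. u \<noteq> 0 \<Longrightarrow> V = L a c (\<bar>u \<bullet> P u\<bar> / norm (T u))"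
    by metis
  \<comment> \<open>An arbitrary fixed direction defines \<open>k\<close>; injectivity of
    \<open>L\<close> gives the same ratio in every other direction.\<close>
  define u0 :: "(real ^ 'n) \<times> real" where "u0 = (0, 1)"
  have u0: "u0 \<noteq> 0" by (simp add: u0_def zero_prod_def)
  define k where "k = \<bar>u0 \<bullet> P u0\<bar> / norm (T u0)"
  have k: "0 \<le> k" "k < 1" "V = L a c k"
    using lt[OF u0] VP[OF u0] u0 by (simp_all add: k_def)
  have abs_support: "\<bar>u \<bullet> P u\<bar> = k * norm (T u)" if u: "u \<noteq> 0" for u
  proof -
    have "\<bar>u \<bullet> P u\<bar> / norm (T u) \<in> {-1..1}"
      using lt[OF u] u by (auto intro: order_trans[of _ 0])
    hence "\<bar>u \<bullet> P u\<bar> / norm (T u) = k"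
      using inj_onD[OF inj_on_L, of "\<bar>u \<bullet> P u\<bar> / norm (T u)" k] VP[OF u] k by simp
    thus ?thesis using u by (simp add: field_simps)
  qed
  obtain x e where x: "e > 0" "ball x e \<subseteq> K"
    using K(3) by (meson all_not_in_conv mem_interior)
  \<comment> \<open>A ball inside \<open>K\<close> makes the width of \<open>K\<close> positive in
    every direction.\<close>
  have width: "u \<bullet> P u + (- u) \<bullet> P (- u) > 0" if u: "u \<noteq> 0" for u
  proof -
    define t where "t = e / (2 * norm u)"
    have t: "t > 0" "t * norm u < e"
      using x u by (simp_all add: t_def)
    have "x + t *\<^sub>R u \<in> K" "x \<in> K"
      using x t by (auto simp: dist_norm)
    with max[of u] max[of "- u"] u
    have "u \<bullet> (x + t *\<^sub>R u) \<le> u \<bullet> P u" "(- u) \<bullet> x \<le> (- u) \<bullet> P (- u)"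
      by (simp_all del: inner_minus_left)
    hence "t * (u \<bullet> u) \<le> u \<bullet> P u + (- u) \<bullet> P (- u)"
      by (simp add: inner_add_right)
    moreover have "t * (u \<bullet> u) > 0" using t u by simp
    ultimately show ?thesis by linarith
  qed
  \<comment> \<open>The values at \<open>u\<close> and \<open>- u\<close> have the same modulus, so
    a negative sign in either would make their sum at most 0.\<close>
  have support: "u \<bullet> P u = k * norm (T u)" if u: "u \<noteq> 0" for u
    using abs_support[OF u] abs_support[of "- u"] width[OF u] u
    by (simp add: linear_neg[OF linear_stretch])
  have "k \<noteq> 0"
    using support[OF u0] support[of "- u0"] width[OF u0] u0 by auto
  with k have k0: "0 < k" by simp
  have "K = {q. ell a c q \<le> k\<^sup>2}"
  proof (intro equalityI subsetI)
    fix q assume q: "q \<in> K"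
    have "norm (T' q) \<le> k"
    proof (cases "T' q = 0")
      case False
      \<comment> \<open>The test direction is the normal at \<open>q\<close> of the ellipsoid
        through \<open>q\<close>; there the support inequality bounds \<open>norm (T' q)\<close>
        itself.\<close>
      hence nz: "T' (T' q) \<noteq> 0" by (metis T_eq_0_iff T_T')
      have "(norm (T' q))\<^sup>2 \<le> k * norm (T' q)"
        using max[OF nz q] support[OF nz] by (simp add: inner_normal power2_norm_eq_inner)
      with False show ?thesis by (simp add: power2_eq_square)
    qed (use k in simp)
    thus "q \<in> {q. ell a c q \<le> k\<^sup>2}"
      using k by (simp add: ell_le_power2_iff)
  next
    fix q assume "q \<in> {q. ell a c q \<le> k\<^sup>2}"
    hence q: "norm (T' q) \<le> k"
      using k by (simp add: ell_le_power2_iff)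
    show "q \<in> K"
    proof (rule ccontr)
      assume "q \<notin> K"
      then obtain u b where u: "u \<bullet> q < b" "\<And>y. y \<in> K \<Longrightarrow> b < u \<bullet> y"
        using separating_hyperplane_closed_point[OF K(2) closed] by blast
      have "u \<noteq> 0" using u K_ne by fastforce
      \<comment> \<open>The separation puts \<open>K\<close> on the side of larger values of
        \<open>u\<close>, so the support function is evaluated at \<open>- u\<close>.\<close>
      hence "(- u) \<bullet> P (- u) < (- u) \<bullet> q"
        using u(1) u(2)[OF P, of "- u"] by simp
      also have "\<dots> \<le> norm (T (- u)) * norm (T' q)"
        by (rule inner_le_norm_T)
      also have "\<dots> \<le> norm (T (- u)) * k"
        using q by (rule mult_left_mono) simp
      finally show False
        using support[of "- u"] \<open>u \<noteq> 0\<close> by (simp add: mult.commute)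
    qed
  qed
  with k k0 show ?thesis by (intro that)
qed

end

section \<open>Factoring the defining function\<close>

text \<open>The mean value theorem along the ray through \<open>q\<close>. The unordered
  \<open>closed_segment\<close> admits \<open>t\<close> on either side of 1; for
  \<open>t = 1\<close> both sides vanish.\<close>

lemma mvt_radial:
  fixes \<phi> :: "'a::real_normed_vector \<Rightarrow> real"
  assumes \<phi>': "\<And>s. s \<in> closed_segment 1 t \<Longrightarrow> (\<phi> has_derivative blinfun_apply (\<phi>' (s *\<^sub>R q))) (at (s *\<^sub>R q))"
  obtains s where "s \<in> closed_segment 1 t" "\<phi> q - \<phi> (t *\<^sub>R q) = (1 - t) * \<phi>' (s *\<^sub>R q) q"
proof -
  have deriv: "((\<lambda>s. \<phi> (s *\<^sub>R q)) has_real_derivative \<phi>' (s *\<^sub>R q) q) (at s)" if "s \<in> closed_segment 1 t" for s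
  proof -
    have "((\<lambda>s. \<phi> (s *\<^sub>R q)) has_derivative (\<lambda>r. \<phi>' (s *\<^sub>R q) (r *\<^sub>R q))) (at s)"
      by (rule has_derivative_compose[of "\<lambda>s. s *\<^sub>R q" _ s UNIV \<phi>, OF _ \<phi>'[OF that]])
         (auto intro!: derivative_eq_intros)
    thus ?thesis
      by (simp add: has_field_derivative_def blinfun.scaleR_right mult_commute_abs)
  qed
  consider "t < 1" | "t = 1" | "1 < t" by linarith
  thus ?thesis
  proof cases
    case 1
    then obtain s where "t < s" "s < 1" "\<phi> (1 *\<^sub>R q) - \<phi> (t *\<^sub>R q) = (1 - t) * \<phi>' (s *\<^sub>R q) q"
      using MVT2[of t 1 "\<lambda>s. \<phi> (s *\<^sub>R q)" "\<lambda>s. \<phi>' (s *\<^sub>R q) q"] deriv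
      by (auto simp: closed_segment_eq_real_ivl)
    with 1 show ?thesis by (intro that[of s]) (auto simp: closed_segment_eq_real_ivl)
  next
    case 2
    thus ?thesis by (intro that[of 1]) auto
  next
    case 3
    then obtain s where "1 < s" "s < t" "\<phi> (t *\<^sub>R q) - \<phi> (1 *\<^sub>R q) = (t - 1) * \<phi>' (s *\<^sub>R q) q"
      using MVT2[of 1 t "\<lambda>s. \<phi> (s *\<^sub>R q)" "\<lambda>s. \<phi>' (s *\<^sub>R q) q"] deriv
      by (auto simp: closed_segment_eq_real_ivl)
    with 3 show ?thesis by (intro that[of s]) (auto simp: closed_segment_eq_real_ivl algebra_simps)
  qed
qed

text \<open>Off the surface the quotient of two continuous functions with the same zeros in
  \<open>A\<close> serves. On the surface its limit is a radial derivative of \<phi>, nonzero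
  because the radius is transversal to the tangent hyperplane.\<close>

lemma (in ellipsoid) factor_defining_function:
  assumes k: "0 < k" and \<phi>: "C2_defining_function A \<phi> {q. ell a c q = k\<^sup>2}"
  shows "\<exists>\<mu>. continuous_on A \<mu> \<and> (\<forall>q\<in>A. \<mu> q \<noteq> 0 \<and> \<phi> q = \<mu> q * (ell a c q - k\<^sup>2))"
proof -
  have A: "open A" and C2: "C2_on A \<phi>" and M: "{q. ell a c q = k\<^sup>2} = {p \<in> A. \<phi> p = 0}"
    using \<phi> by (auto simp: C2_defining_function_def)
  obtain \<phi>' where \<phi>': "\<forall>p\<in>A. (\<phi> has_derivative blinfun_apply (\<phi>' p)) (at p)"
    and cont': "continuous_on A \<phi>'" and cont: "continuous_on A \<phi>"
    using C2 by (rule C2_onE)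
  define N where "N q = norm (T' q)" for q
  have ell_N: "ell a c q = (N q)\<^sup>2" for q
    by (simp add: N_def ell_eq)
  have N_scaleR: "N (r *\<^sub>R q) = \<bar>r\<bar> * N q" for r q
    by (simp add: N_def linear_cmul[OF linear_stretch])
  have N_nonneg: "0 \<le> N q" for q by (simp add: N_def)
  have zero_iff: "\<phi> q = 0 \<longleftrightarrow> N q = k" if "q \<in> A" for q
  proof -
    have "\<phi> q = 0 \<longleftrightarrow> ell a c q = k\<^sup>2"
      using that M by blast
    thus ?thesis
      using k N_nonneg[of q] by (simp add: ell_N)
  qed
  have in_A: "q \<in> A" if "N q = k" for q
    using that M by (auto simp: ell_N)
  have N_cont: "isCont N p" for p
    unfolding N_def
    by (intro continuous_intros linear_continuous_at linear_conv_bounded_linear[THEN iffD1] linear_stretch)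
  have nonzero: "\<phi>' p p \<noteq> 0" if Np: "N p = k" for p
  proof -
    have pA: "p \<in> A" "\<phi> p = 0"
      using in_A[OF Np] zero_iff Np by auto
    obtain w where "frechet_derivative \<phi> (at p) w \<noteq> 0"
      using C2_defining_function_derivative_nonzero[OF \<phi>, of p] Np by (auto simp: ell_N)
    hence w: "\<phi>' p w \<noteq> 0"
      by (simp flip: frechet_derivative_at[OF bspec[OF \<phi>' pA(1)]])
    have up: "T' (T' p) \<bullet> p = k\<^sup>2"
      using Np by (simp add: inner_normal N_def flip: power2_norm_eq_inner)
    have u: "T' (T' p) \<noteq> 0"
      using up k by auto
    have "T' (T' p) \<bullet> q \<le> T' (T' p) \<bullet> p" if "q \<in> A" "\<phi> q = 0" for q
      using inner_le_norm_T[of "T' (T' p)" q] zero_iff[OF that(1)] that(2) Np up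
      by (simp add: N_def power2_eq_square)
    \<comment> \<open>The ellipsoid lies on one side of its tangent hyperplane at \<open>p\<close>,
      so the kernel of the derivative is the orthogonal complement of \<open>T' (T' p)\<close>; the
      vector \<open>p\<close> is not in it.\<close>
    hence "\<phi>' p p = 0 \<longleftrightarrow> T' (T' p) \<bullet> p = 0"
      by (intro derivative_parallel_to_support_direction[OF A pA(1) cont bspec[OF \<phi>' pA(1)] w u pA(2)])
    thus ?thesis using up k by simp
  qed
  \<comment> \<open>On the surface this is the radial derivative of \<open>\<phi>\<close> over that of \<open>\<ell>\<close>, as \<open>\<ell>\<close> is homogeneous of degree 2.\<close>
  define \<mu> where "\<mu> q = (if N q = k then \<phi>' q q / (2 * k\<^sup>2) else \<phi> q / (ell a c q - k\<^sup>2))" for q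
  have diff_nz: "ell a c q - k\<^sup>2 \<noteq> 0" if "N q \<noteq> k" for q
    using that k N_nonneg[of q] by (simp add: ell_N)
  have "isCont \<mu> p" if p: "p \<in> A" for p
  proof (cases "N p = k")
    case False
    have "eventually (\<lambda>q. N q \<noteq> k) (nhds p)"
      using N_cont[of p] False by (simp add: continuous_at_imp_continuous_within tendsto_imp_eventually_ne continuous_at eventually_nhds_conv_at)
    hence "eventually (\<lambda>q. \<mu> q = \<phi> q / (ell a c q - k\<^sup>2)) (nhds p)"
      by eventually_elim (simp add: \<mu>_def)
    moreover have "isCont (\<lambda>q. \<phi> q / (ell a c q - k\<^sup>2)) p"
      using cont continuous_on_ell[of A] A p diff_nz[OF False]
      by (intro continuous_intros) (auto simp: continuous_on_eq_continuous_at)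
    ultimately show ?thesis by (simp add: isCont_cong)
  next
    case Np: True
    \<comment> \<open>The factor that moves \<open>q\<close> along its ray onto the surface.\<close>
    define r where "r q = k / N q" for q
    have r_lim: "r \<midarrow>p\<rightarrow> 1"
    proof -
      have "(\<lambda>q. k / N q) \<midarrow>p\<rightarrow> k / N p"
        using N_cont[of p] Np k by (intro tendsto_intros) (auto simp: isCont_def)
      thus ?thesis using Np k by (simp add: r_def[abs_def])
    qed
    obtain e where e: "e > 0" "ball p e \<subseteq> A"
      using A p open_contains_ball by blast
    \<comment> \<open>For \<open>q\<close> near \<open>p\<close> the whole radial segment from
      \<open>q\<close> to the surface stays near \<open>p\<close>, hence inside
      \<open>A\<close>.\<close>
    have dist_seg: "norm (s *\<^sub>R q - p) \<le> \<bar>1 - r q\<bar> * norm q + norm (q - p)"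
      if "s \<in> closed_segment 1 (r q)" for s q
    proof -
      have "norm (s *\<^sub>R q - p) = norm ((s - 1) *\<^sub>R q + (q - p))"
        by (simp add: algebra_simps)
      also have "\<dots> \<le> \<bar>s - 1\<bar> * norm q + norm (q - p)"
        by (metis norm_triangle_ineq norm_scaleR)
      also have "\<bar>s - 1\<bar> \<le> \<bar>1 - r q\<bar>"
        using that by (auto simp: closed_segment_eq_real_ivl split: if_splits)
      finally show ?thesis by (simp add: mult_right_mono)
    qed
    have "(\<lambda>q. \<bar>1 - r q\<bar> * norm q + norm (q - p)) \<midarrow>p\<rightarrow> \<bar>1 - 1\<bar> * norm p + norm (p - p)"
      by (intro tendsto_intros r_lim)
    hence "eventually (\<lambda>q. \<bar>1 - r q\<bar> * norm q + norm (q - p) < e) (at p)"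
      using e(1) by (intro order_tendstoD(2)) auto
    moreover have "eventually (\<lambda>q. 0 < N q) (at p)"
      using N_cont[of p] Np k by (intro order_tendstoD(1)[of N "N p"]) (auto simp: isCont_def)
    moreover have "eventually (\<lambda>q. q \<in> A) (at p)"
      using A p by (simp add: eventually_at_in_open')
    \<comment> \<open>Both \<open>1 - r q = (N q - k) / N q\<close> and
      \<open>ell a c q - k\<^sup>2 = (N q - k) * (N q + k)\<close> contain \<open>N q - k\<close>,
      which cancels. On the surface \<open>s = 1\<close> reproduces the value assigned to
      \<mu>.\<close>
    ultimately have ev: "eventually (\<lambda>q. \<exists>s\<in>closed_segment 1 (r q). \<mu> q = \<phi>' (s *\<^sub>R q) q / (N q * (N q + k))) (at p)"
    proof eventually_elim
      case (elim q)
      show ?case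
      proof (cases "N q = k")
        case True
        thus ?thesis using k by (intro bexI[of _ 1]) (auto simp: \<mu>_def power2_eq_square)
      next
        case False
        have "s *\<^sub>R q \<in> A" if "s \<in> closed_segment 1 (r q)" for s
          using dist_seg[OF that] elim e by (auto simp: dist_norm norm_minus_commute)
        with \<phi>' obtain s where s: "s \<in> closed_segment 1 (r q)" "\<phi> q - \<phi> (r q *\<^sub>R q) = (1 - r q) * \<phi>' (s *\<^sub>R q) q"
          by (rule_tac mvt_radial[of "r q" \<phi> \<phi>' q]) blast+
        have "N (r q *\<^sub>R q) = k"
          using elim k by (simp add: N_scaleR r_def)
        hence "\<phi> (r q *\<^sub>R q) = 0"
          using zero_iff in_A by blast
        hence "\<phi> q = (N q - k) / N q * \<phi>' (s *\<^sub>R q) q"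
          using s(2) elim by (simp add: r_def diff_divide_distrib)
        moreover have "ell a c q - k\<^sup>2 = (N q - k) * (N q + k)"
          by (simp add: ell_N power2_eq_square algebra_simps)
        ultimately have "\<mu> q = \<phi>' (s *\<^sub>R q) q / (N q * (N q + k))"
          using False by (simp add: \<mu>_def)
        with s(1) show ?thesis by blast
      qed
    qed
    \<comment> \<open>The intermediate parameters are merely chosen, without any continuity; they
      tend to 1 because they lie between 1 and \<open>r q\<close>.\<close>
    define s where "s q = (SOME s. s \<in> closed_segment 1 (r q) \<and> \<mu> q = \<phi>' (s *\<^sub>R q) q / (N q * (N q + k)))" for q
    have s: "eventually (\<lambda>q. s q \<in> closed_segment 1 (r q) \<and> \<mu> q = \<phi>' (s q *\<^sub>R q) q / (N q * (N q + k))) (at p)"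
      using ev by eventually_elim (unfold s_def, rule someI_ex, blast)
    have s_lim: "s \<midarrow>p\<rightarrow> 1"
    proof -
      have "(\<lambda>q. s q - 1) \<midarrow>p\<rightarrow> 0"
      proof (rule Lim_null_comparison)
        show "eventually (\<lambda>q. norm (s q - 1) \<le> \<bar>r q - 1\<bar>) (at p)"
          using s by eventually_elim (auto simp: closed_segment_eq_real_ivl split: if_splits)
        show "(\<lambda>q. \<bar>r q - 1\<bar>) \<midarrow>p\<rightarrow> 0"
          using tendsto_rabs[OF tendsto_diff[OF r_lim tendsto_const[of 1]]] by simp
      qed
      thus ?thesis using Lim_null by blast
    qed
    have "isCont \<phi>' p"
      using cont' A p by (simp add: continuous_on_eq_continuous_at)
    moreover have "(\<lambda>q. s q *\<^sub>R q) \<midarrow>p\<rightarrow> p"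
      using tendsto_scaleR[OF s_lim tendsto_ident_at[of p UNIV]] by simp
    ultimately have "(\<lambda>q. \<phi>' (s q *\<^sub>R q)) \<midarrow>p\<rightarrow> \<phi>' p"
      by (rule isCont_tendsto_compose)
    hence lim: "(\<lambda>q. \<phi>' (s q *\<^sub>R q) q / (N q * (N q + k))) \<midarrow>p\<rightarrow> \<phi>' p p / (N p * (N p + k))"
      using N_cont[of p] Np k by (intro tendsto_intros) (auto simp: isCont_def)
    have "eventually (\<lambda>q. \<phi>' (s q *\<^sub>R q) q / (N q * (N q + k)) = \<mu> q) (at p)"
      using s by eventually_elim simp
    with lim have "\<mu> \<midarrow>p\<rightarrow> \<phi>' p p / (N p * (N p + k))"
      by (rule Lim_transform_eventually)
    moreover have "\<phi>' p p / (N p * (N p + k)) = \<mu> p"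
      using Np by (simp add: \<mu>_def power2_eq_square)
    ultimately show ?thesis by (simp add: isCont_def)
  qed
  hence "continuous_on A \<mu>"
    by (simp add: continuous_at_imp_continuous_on)
  moreover have "\<mu> q \<noteq> 0 \<and> \<phi> q = \<mu> q * (ell a c q - k\<^sup>2)" if "q \<in> A" for q
    using nonzero[of q] zero_iff[OF that] diff_nz[of q] k by (auto simp: \<mu>_def ell_N)
  ultimately show ?thesis by blast
qed

theorem theorem6:
  fixes a :: "real ^ 'n" and c :: real
  assumes "\<forall>i. a $ i > 0" and "c > 0"
  shows
    "(\<forall>k. 0 < k \<and> k < 1 \<longrightarrow>
        (\<forall>H \<in> tangent_hyperplanes UNIV (\<lambda>q. ell a c q - k\<^sup>2).
           (\<exists>S. smaller_part_cut_off {q. ell a c q \<le> 1} H S) \<and>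
           (\<forall>S. smaller_part_cut_off {q. ell a c q \<le> 1} H S \<longrightarrow>
              compact S \<and> measure lebesgue S = L a c k))) \<and>
     (\<forall>A \<phi> M V.
        C2_ovaloid M \<and> C2_defining_function A \<phi> M \<and> M \<subseteq> {q. ell a c q < 1} \<and>
        (\<forall>H \<in> tangent_hyperplanes A \<phi>. \<forall>S.
           smaller_part_cut_off {q. ell a c q \<le> 1} H S \<longrightarrow> measure lebesgue S = V) \<longrightarrow>
        inj_on (L a c) {0<..<1} \<and> V \<in> L a c ` {0<..<1} \<and>
        (let k = the_inv_into {0<..<1} (L a c) V in
           M = {q. ell a c q = k\<^sup>2} \<and>
           (\<exists>\<mu>. continuous_on A \<mu> \<and>
              (\<forall>q\<in>A. \<mu> q \<noteq> 0 \<and> \<phi> q = \<mu> q * (ell a c q - k\<^sup>2)))))"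
proof -
  interpret ellipsoid a c
    using assms by unfold_locales auto
  have inj: "inj_on (L a c) {0<..<1}"
    by (rule inj_on_subset[OF inj_on_L]) auto
  show ?thesis
  proof (intro conjI allI impI ballI; (elim conjE)?)
    fix k H assume "0 < k" "k < 1" "H \<in> tangent_hyperplanes UNIV (\<lambda>q. ell a c q - k\<^sup>2)"
    note * = cut_off_by_tangent_hyperplane_ell[OF this]
    show "\<exists>S. smaller_part_cut_off {q. ell a c q \<le> 1} H S" by (rule *(1))
    show "compact S" "measure lebesgue S = L a c k"
      if "smaller_part_cut_off {q. ell a c q \<le> 1} H S" for S
      using *(2)[OF that] by blast+
  next
    fix A \<phi> M V
    assume "C2_ovaloid M" and \<phi>: "C2_defining_function A \<phi> M" and inside: "M \<subseteq> {q. ell a c q < 1}"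
      and V: "\<forall>H \<in> tangent_hyperplanes A \<phi>. \<forall>S.
           smaller_part_cut_off {q. ell a c q \<le> 1} H S \<longrightarrow> measure lebesgue S = V"
    then obtain K where K: "compact K" "convex K" "interior K \<noteq> {}" "M = frontier K"
      unfolding C2_ovaloid_def by blast
    have V': "measure lebesgue S = V"
      if "H \<in> tangent_hyperplanes A \<phi>" "smaller_part_cut_off {q. ell a c q \<le> 1} H S" for H S
      using V that by blast
    obtain k where k: "0 < k" "k < 1" "V = L a c k" "K = {q. ell a c q \<le> k\<^sup>2}"
      by (rule constant_cut_off_imp_ellipsoid[OF K(1-3) \<phi>[unfolded K(4)] inside[unfolded K(4)] V'])
    have M: "M = {q. ell a c q = k\<^sup>2}"
      unfolding K(4) k(4) using k(1) by (rule frontier_ell_le)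
    have inv: "the_inv_into {0<..<1} (L a c) V = k"
      using inj k by (simp add: the_inv_into_f_f)
    show "inj_on (L a c) {0<..<1}" by (rule inj)
    show "V \<in> L a c ` {0<..<1}" using k by auto
    show "let k = the_inv_into {0<..<1} (L a c) V in
           M = {q. ell a c q = k\<^sup>2} \<and>
           (\<exists>\<mu>. continuous_on A \<mu> \<and>
              (\<forall>q\<in>A. \<mu> q \<noteq> 0 \<and> \<phi> q = \<mu> q * (ell a c q - k\<^sup>2)))"
      unfolding inv Let_def
      using M factor_defining_function[OF k(1) \<phi>[unfolded M]] by blast
  qed
qed

end
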